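(* Let $(X,\mathcal{B},\mu,T)$ be an ergodic measure-preserving dynamical system on a non-atomic probability space. Let $\alpha>2$, let $f\ge 0$ satisfy $\int_X f\,(\log^+ f)^{2\alpha}\,d\mu<\infty$ (i.e. $f\in L(\log L)^{2\alpha}$), and let $g\ge 0$ with $g\in L^1(\mu)$. Then $$R^*(f,g)(x)=\sup_{n\ge1}\frac{f(T^nx)\,g(T^{2n}x)}{n}$$ is finite for $\mu$-almost every $x\in X$.
   Context: $\log^+ t=\max\{\log t,0\}$ for $t>0$ (and $0$ for $t=0$). *)

theory Defs
  imports "HOL-Probability.Probability"
begin

definition logplus :: "real \<Rightarrow> real" where
  "logplus t = (if t > 0 then max (ln t) 0 else 0)"

definition measure_preserving_map :: "'a measure \<Rightarrow> ('a \<Rightarrow> 'a) \<Rightarrow> bool" where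
  "measure_preserving_map M T \<longleftrightarrow> T \<in> M \<rightarrow>\<^sub>M M \<and>
     (\<forall>A \<in> sets M. emeasure M (T -` A \<inter> space M) = emeasure M A)"

definition ergodic_map :: "'a measure \<Rightarrow> ('a \<Rightarrow> 'a) \<Rightarrow> bool" where
  "ergodic_map M T \<longleftrightarrow> measure_preserving_map M T \<and>
     (\<forall>A \<in> sets M. T -` A \<inter> space M = A \<longrightarrow> measure M A = 0 \<or> measure M A = 1)"

definition non_atomic :: "'a measure \<Rightarrow> bool" where
  "non_atomic M \<longleftrightarrow> (\<forall>A \<in> sets M. emeasure M A > 0 \<longrightarrow>
     (\<exists>B \<in> sets M. B \<subseteq> A \<and> 0 < emeasure M B \<and> emeasure M B < emeasure M A))"

end

theory Submission
  imports Defs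
begin

text \<open>
  Call \<open>x\<close> bad at level \<open>k\<close> if for some \<open>n\<close> both \<open>2\<^sup>k \<le> f (T\<^sup>n x) < 2\<^sup>k\<^sup>+\<^sup>1\<close> and
  \<open>n \<le> 2\<^sup>k\<^sup>+\<^sup>1 g (T\<^sup>2\<^sup>n x)\<close>. By transference to orbit segments, bounding the measure of the bad set is
  a counting problem on the integers: given a set \<open>A\<close> and a height \<open>l y\<close> at every point \<open>y\<close>, count the
  \<open>y - 2n\<close> with \<open>n \<le> l y\<close> and \<open>y - n \<in> A\<close>. Fix a threshold \<open>t\<close>. If \<open>A\<close> has density less than \<open>t\<close> in
  \<open>[y - l y, y)\<close>, then \<open>y\<close> contributes at most \<open>t l y\<close> points. The remaining intervals are dense in
  \<open>A\<close>, so by a Vitali covering argument their doubles cover at most \<open>4 |A| / t\<close> points. The choice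
  \<open>t = 2\<^sup>-\<^sup>k k\<^sup>-\<^sup>2\<close> makes both bounds summable in \<open>k\<close>, the second one because
  \<open>f (log\<^sup>+ f)\<^sup>2\<close> is integrable, and the Borel--Cantelli lemma disposes of the large values of \<open>f\<close>.
  For bounded \<open>f\<close> it suffices that \<open>g (T\<^sup>2\<^sup>n x) < n\<close> eventually.
\<close>

section \<open>Counting on the integers\<close>

text \<open>Greedy Vitali selection. Take the longest interval, ending at \<open>J\<close>. Every
  interval meeting it has its double inside a window of at most \<open>4 * l J\<close> points, paid
  for by the points of \<open>A\<close> below \<open>J\<close>. Intervals disjoint from it are left
  to the induction, and they use other points of \<open>A\<close>, so nothing is paid for
  twice.\<close>

lemma card_union_dense_intervals:
  fixes l :: "nat \<Rightarrow> nat" and t :: real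
  assumes "finite Y" "finite A" "t > 0"
    and "\<And>y. y \<in> Y \<Longrightarrow> t * l y \<le> card (A \<inter> {y - l y..<y})"
  shows "t * card (\<Union>y\<in>Y. {y - 2 * l y..<y}) \<le> 4 * card (A \<inter> (\<Union>y\<in>Y. {y - l y..<y}))"
  using assms(1,4)
proof (induction Y rule: finite_psubset_induct)
  case (psubset Y)
  show ?case
  proof (cases "Y = {}")
    case False
    have "finite (l ` Y)" "l ` Y \<noteq> {}" using psubset.hyps False by auto
    then obtain J where J: "J \<in> Y" "l J = Max (l ` Y)"
      by (metis (no_types, lifting) Max_in imageE)
    have Jmax: "l y \<le> l J" if "y \<in> Y" for y
      using J(2) that psubset.hyps by simp
    \<comment> \<open>\<open>J\<close> is removed by hand: when \<open>l J = 0\<close> its interval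
      is empty and does not even meet itself. This keeps \<open>Y'\<close> a proper subset of
      \<open>Y\<close>.\<close>
    define Y' where "Y' = {y \<in> Y - {J}. {y - l y..<y} \<inter> {J - l J..<J} = {}}"
    have sub: "Y' \<subset> Y" using J(1) by (auto simp: Y'_def)
    have IH: "t * card (\<Union>y\<in>Y'. {y - 2 * l y..<y}) \<le> 4 * card (A \<inter> (\<Union>y\<in>Y'. {y - l y..<y}))"
      by (rule psubset.IH[OF sub]) (use psubset.prems sub in auto)
    have fin: "finite Y'" using sub psubset.hyps finite_subset by auto
    have "(\<Union>y\<in>Y. {y - 2 * l y..<y}) \<subseteq> {J - 3 * l J..<J + l J} \<union> (\<Union>y\<in>Y'. {y - 2 * l y..<y})"
    proof
      fix x assume "x \<in> (\<Union>y\<in>Y. {y - 2 * l y..<y})"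
      then obtain y where y: "y \<in> Y" "y - 2 * l y \<le> x" "x < y" by auto
      show "x \<in> {J - 3 * l J..<J + l J} \<union> (\<Union>y\<in>Y'. {y - 2 * l y..<y})"
      proof (cases "y \<in> Y'")
        case True then show ?thesis using y by auto
      next
        case False
        then have "y = J \<or> (\<exists>z. z \<in> {y - l y..<y} \<and> z \<in> {J - l J..<J})"
          using y(1) unfolding Y'_def by blast
        then have "y = J \<or> (\<exists>z. y - l y \<le> z \<and> z < y \<and> J - l J \<le> z \<and> z < J)"
          unfolding atLeastLessThan_iff by blast
        \<comment> \<open>A common point \<open>z\<close> gives \<open>y < J + l y\<close> and
          \<open>y - 2 * l y > z - 2 * l y\<close>, where \<open>z\<close> is at least
          \<open>J - l J\<close>; the maximality of \<open>l J\<close> does the rest.\<close>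
        then have "J - 3 * l J \<le> x \<and> x < J + l J"
          using Jmax[OF y(1)] y(2,3) by linarith
        then show ?thesis by simp
      qed
    qed
    then have "card (\<Union>y\<in>Y. {y - 2 * l y..<y})
        \<le> card ({J - 3 * l J..<J + l J} \<union> (\<Union>y\<in>Y'. {y - 2 * l y..<y}))"
      using fin by (intro card_mono) auto
    also have "\<dots> \<le> 4 * l J + card (\<Union>y\<in>Y'. {y - 2 * l y..<y})"
      by (rule order_trans[OF card_Un_le]) simp
    finally have "t * card (\<Union>y\<in>Y. {y - 2 * l y..<y})
        \<le> t * (4 * l J + card (\<Union>y\<in>Y'. {y - 2 * l y..<y}))"
      using \<open>t > 0\<close> by (intro mult_left_mono) linarith+
    also have "\<dots> = 4 * (t * l J) + t * card (\<Union>y\<in>Y'. {y - 2 * l y..<y})"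
      by (simp add: algebra_simps)
    also have "\<dots> \<le> 4 * card (A \<inter> {J - l J..<J}) + 4 * card (A \<inter> (\<Union>y\<in>Y'. {y - l y..<y}))"
      using psubset.prems[OF J(1)] IH by simp
    also have "\<dots> = 4 * card ((A \<inter> {J - l J..<J}) \<union> (A \<inter> (\<Union>y\<in>Y'. {y - l y..<y})))"
      using \<open>finite A\<close> by (subst card_Un_disjoint) (auto simp: Y'_def)
    also have "\<dots> \<le> 4 * card (A \<inter> (\<Union>y\<in>Y. {y - l y..<y}))"
      using \<open>finite A\<close> J(1) sub by (intro of_nat_mono mult_left_mono card_mono) auto
    finally show ?thesis by simp
  qed simp
qed

text \<open>The three points \<open>i\<close>, \<open>i + n\<close>, \<open>i + 2 * n\<close> form a
  progression, so for a fixed endpoint \<open>y\<close> the point \<open>i\<close> is determined by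
  the midpoint \<open>a\<close> in \<open>A\<close>, as \<open>2 * a - y\<close>. Endpoints below
  which \<open>A\<close> is sparse (\<open>G\<close>) are bounded by counting midpoints; for the
  others \<open>i\<close> lies in the doubled interval, and the covering bound applies.\<close>

lemma card_progression_le:
  fixes l :: "nat \<Rightarrow> nat" and t :: real
  assumes "finite Y" "finite A" "t > 0"
  shows "card {i. \<exists>n\<ge>1. i + 2 * n \<in> Y \<and> n \<le> l (i + 2 * n) \<and> i + n \<in> A}
           \<le> t * (\<Sum>y\<in>Y. real (l y)) + 4 / t * card A"
proof -
  define G where "G = {y \<in> Y. card (A \<inter> {y - l y..<y}) < t * l y}"
  define U where "U = (\<Union>y\<in>Y - G. {y - 2 * l y..<y})"
  define V where "V = (\<Union>y\<in>G. (\<lambda>a. 2 * a - y) ` (A \<inter> {y - l y..<y}))"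
  have fin: "finite G" "finite (Y - G)" "finite U" "finite V"
    using assms by (auto simp: G_def U_def V_def)
  have "{i. \<exists>n\<ge>1. i + 2 * n \<in> Y \<and> n \<le> l (i + 2 * n) \<and> i + n \<in> A} \<subseteq> V \<union> U"
  proof safe
    fix i n :: nat
    assume n: "1 \<le> n" "i + 2 * n \<in> Y" "n \<le> l (i + 2 * n)" "i + n \<in> A" "i \<notin> U"
    have "i \<in> {i + 2 * n - 2 * l (i + 2 * n)..<i + 2 * n}" using n(1,3) by auto
    then have "i + 2 * n \<in> G" using n(2,5) unfolding U_def by blast
    moreover have "i + n \<in> A \<inter> {i + 2 * n - l (i + 2 * n)..<i + 2 * n}"
      using n by auto
    moreover have "i = 2 * (i + n) - (i + 2 * n)" by simp
    ultimately show "i \<in> V" unfolding V_def by blast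
  qed
  then have "card {i. \<exists>n\<ge>1. i + 2 * n \<in> Y \<and> n \<le> l (i + 2 * n) \<and> i + n \<in> A} \<le> card V + card U"
    using fin by (meson card_Un_le card_mono finite_UnI order_trans)
  moreover have "real (card V) \<le> t * (\<Sum>y\<in>Y. real (l y))"
  proof -
    have "card V \<le> (\<Sum>y\<in>G. card ((\<lambda>a. 2 * a - y) ` (A \<inter> {y - l y..<y})))"
      unfolding V_def using fin by (intro card_UN_le) auto
    also have "\<dots> \<le> (\<Sum>y\<in>G. card (A \<inter> {y - l y..<y}))"
      using assms by (intro sum_mono card_image_le) auto
    finally have "real (card V) \<le> (\<Sum>y\<in>G. real (card (A \<inter> {y - l y..<y})))"
      by (metis of_nat_le_iff of_nat_sum)
    also have "\<dots> \<le> (\<Sum>y\<in>G. t * l y)" by (intro sum_mono) (auto simp: G_def)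
    also have "\<dots> \<le> (\<Sum>y\<in>Y. t * l y)"
      using assms by (intro sum_mono2) (auto simp: G_def)
    finally show ?thesis by (simp add: sum_distrib_left)
  qed
  moreover have "real (card U) \<le> 4 / t * card A"
  proof -
    have "t * card U \<le> 4 * card (A \<inter> (\<Union>y\<in>Y - G. {y - l y..<y}))"
      unfolding U_def using fin assms
      by (intro card_union_dense_intervals) (auto simp: G_def not_less)
    also have "\<dots> \<le> 4 * card A" using assms by (simp add: card_mono)
    finally show ?thesis using assms by (simp add: field_simps)
  qed
  ultimately show ?thesis by linarith
qed

section \<open>Transference to measure-preserving maps\<close>

lemma measure_preserving_distr_funpow:
  assumes "measure_preserving_map M T"
  shows "distr M M (T ^^ n) = M"
proof (induction n)
  case 0
  then show ?case by (simp add: distr_id[unfolded id_def] id_def)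
next
  case (Suc n)
  have T: "T \<in> M \<rightarrow>\<^sub>M M" using assms by (simp add: measure_preserving_map_def)
  have "distr M M T = M"
    using assms by (intro measure_eqI) (auto simp: emeasure_distr measure_preserving_map_def)
  moreover have "distr M M (T ^^ Suc n) = distr (distr M M (T ^^ n)) M T"
    using T by (simp add: distr_distr measurable_compose_n)
  ultimately show ?case using Suc by metis
qed

context
  fixes M :: "'a measure" and T :: "'a \<Rightarrow> 'a"
  assumes prob: "prob_space M" and mp: "measure_preserving_map M T"
begin

interpretation prob_space M by (rule prob)

lemma funpow_measurable [measurable]: "T ^^ n \<in> M \<rightarrow>\<^sub>M M"
  using mp by (intro measurable_compose_n) (simp add: measure_preserving_map_def)

lemma integral_funpow:
  fixes u :: "'a \<Rightarrow> real"
  assumes "u \<in> borel_measurable M"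
  shows "integral\<^sup>L M (\<lambda>x. u ((T ^^ n) x)) = integral\<^sup>L M u"
  using integral_distr[OF funpow_measurable assms, of n]
  by (simp add: measure_preserving_distr_funpow[OF mp])

lemma integrable_funpow:
  fixes u :: "'a \<Rightarrow> real"
  assumes "integrable M u"
  shows "integrable M (\<lambda>x. u ((T ^^ n) x))"
  using assms integrable_distr_eq[OF funpow_measurable, of u n]
  by (simp add: measure_preserving_distr_funpow[OF mp])

lemma funpow_in_space: "x \<in> space M \<Longrightarrow> (T ^^ n) x \<in> space M"
  using funpow_measurable measurable_space by metis

text \<open>Transference: apply the counting bound along the orbit of each \<open>x\<close>,
  integrate using invariance, divide by the length \<open>N\<close> and let it grow. The cap
  \<open>m\<close> on \<open>n\<close> keeps the overhang of the orbit segment bounded.\<close>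

lemma measure_return_bounded_le:
  fixes h :: "'a \<Rightarrow> real" and t :: real
  assumes A [measurable]: "A \<in> sets M" and h: "integrable M h" "\<And>x. x \<in> space M \<Longrightarrow> h x \<ge> 0"
    and t: "t > 0"
  shows "measure M {x \<in> space M. \<exists>n\<in>{1..m}. (T ^^ n) x \<in> A \<and> n \<le> h ((T ^^ (2 * n)) x)}
           \<le> t * integral\<^sup>L M h + 4 / t * measure M A"
proof -
  have [measurable]: "h \<in> borel_measurable M" using h by auto
  define B where "B = {x \<in> space M. \<exists>n\<in>{1..m}. (T ^^ n) x \<in> A \<and> n \<le> h ((T ^^ (2 * n)) x)}"
  have B [measurable]: "B \<in> sets M" unfolding B_def by measurable
  define c where "c = t * integral\<^sup>L M h + 4 / t * measure M A"
  have *: "N * measure M B \<le> (N + 2 * m) * c" for N :: nat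
  proof -
    \<comment> \<open>Whether \<open>(T ^^ i) x\<close> lies in \<open>B\<close> for
      \<open>i < N\<close> depends only on orbit points at times below
      \<open>N + 2 * m\<close>.\<close>
    have pt: "(\<Sum>i<N. indicator B ((T ^^ i) x))
        \<le> t * (\<Sum>j<N + 2 * m. h ((T ^^ j) x)) + 4 / t * (\<Sum>j<N + 2 * m. indicator A ((T ^^ j) x))"
      (is "?L \<le> ?R") if x: "x \<in> space M" for x
    proof -
      \<comment> \<open>For a natural number \<open>n\<close>, being at most \<open>h\<close> and
        being at most its floor are the same.\<close>
      define l where "l j = nat \<lfloor>h ((T ^^ j) x)\<rfloor>" for j
      define Y where "Y = {..<N + 2 * m}"
      define A' where "A' = {j \<in> Y. (T ^^ j) x \<in> A}"
      define S where "S = {i. \<exists>n\<ge>1. i + 2 * n \<in> Y \<and> n \<le> l (i + 2 * n) \<and> i + n \<in> A'}"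
      have h0: "h ((T ^^ j) x) \<ge> 0" for j using h(2) funpow_in_space[OF x] by auto
      have "?L = (\<Sum>i<N. if (T ^^ i) x \<in> B then 1 else 0)"
        by (intro sum.cong) (auto simp: indicator_def)
      also have "\<dots> = card {i\<in>{..<N}. (T ^^ i) x \<in> B}"
        by (simp flip: sum.inter_filter)
      also have "\<dots> \<le> card S"
      proof (intro of_nat_mono card_mono subsetI)
        show "finite S" by (rule finite_subset[of _ Y]) (auto simp: S_def Y_def)
        fix i assume i: "i \<in> {i\<in>{..<N}. (T ^^ i) x \<in> B}"
        then obtain n where n: "1 \<le> n" "n \<le> m" "(T ^^ n) ((T ^^ i) x) \<in> A"
            "n \<le> h ((T ^^ (2 * n)) ((T ^^ i) x))"
          by (auto simp: B_def)
        have "(T ^^ (i + n)) x \<in> A" "n \<le> h ((T ^^ (i + 2 * n)) x)"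
          using n(3,4) by (simp_all add: funpow_add add.commute[of i])
        then show "i \<in> S"
          unfolding S_def A'_def Y_def l_def using n(1,2) i by (auto simp: le_nat_floor intro!: exI[of _ n])
      qed
      also have "\<dots> \<le> t * (\<Sum>y\<in>Y. real (l y)) + 4 / t * card A'"
        unfolding S_def using t by (intro card_progression_le) (auto simp: A'_def Y_def)
      also have "\<dots> \<le> t * (\<Sum>y\<in>Y. h ((T ^^ y) x)) + 4 / t * card A'"
        using t h0 by (intro add_right_mono mult_left_mono sum_mono) (auto simp: l_def)
      also have "real (card A') = (\<Sum>j\<in>Y. if (T ^^ j) x \<in> A then 1 else 0)"
        unfolding A'_def by (simp add: Y_def flip: sum.inter_filter)
      also have "\<dots> = (\<Sum>j\<in>Y. indicator A ((T ^^ j) x))"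
        by (intro sum.cong) (auto simp: indicator_def)
      finally show ?thesis unfolding Y_def .
    qed
    have ind: "integrable M (\<lambda>x. indicator C ((T ^^ i) x) :: real)"
      "integral\<^sup>L M (\<lambda>x. indicator C ((T ^^ i) x) :: real) = measure M C"
      if [measurable]: "C \<in> sets M" for C i
      using integrable_funpow[of "indicator C"] integral_funpow[of "indicator C"] that
      by (auto simp: emeasure_eq_measure)
    have "N * measure M B = integral\<^sup>L M (\<lambda>x. \<Sum>i<N. indicator B ((T ^^ i) x))"
      using ind by simp
    also have "\<dots> \<le> integral\<^sup>L M (\<lambda>x. t * (\<Sum>j<N + 2 * m. h ((T ^^ j) x))
        + 4 / t * (\<Sum>j<N + 2 * m. indicator A ((T ^^ j) x)))"
      using ind h integrable_funpow pt by (intro integral_mono) auto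
    also have "\<dots> = (N + 2 * m) * c"
      using ind h integrable_funpow integral_funpow[of h]
      by (simp add: c_def algebra_simps)
    finally show ?thesis .
  qed
  \<comment> \<open>The factor \<open>(N + 2 * m) / N\<close> tends to 1; a positive gap
    \<open>measure M B - c\<close> would be contradicted at a large \<open>N\<close>.\<close>
  have "measure M B \<le> c"
  proof (rule ccontr)
    assume "\<not> measure M B \<le> c"
    then obtain N :: nat where "2 * m * c < N * (measure M B - c)"
      using ex_less_of_nat_mult[of "measure M B - c" "2 * m * c"] by auto
    then show False using *[of N] by (simp add: algebra_simps)
  qed
  then show ?thesis by (simp add: B_def c_def)
qed

text \<open>The capped bound does not depend on \<open>m\<close>, so continuity from below along the
  increasing capped sets removes the cap.\<close>

lemma measure_return_le:
  fixes h :: "'a \<Rightarrow> real" and t :: real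
  assumes A [measurable]: "A \<in> sets M" and h: "integrable M h" "\<And>x. x \<in> space M \<Longrightarrow> h x \<ge> 0"
    and t: "t > 0"
  shows "measure M {x \<in> space M. \<exists>n\<ge>1. (T ^^ n) x \<in> A \<and> n \<le> h ((T ^^ (2 * n)) x)}
           \<le> t * integral\<^sup>L M h + 4 / t * measure M A"
proof -
  have [measurable]: "h \<in> borel_measurable M" using h by auto
  define B where "B m = {x \<in> space M. \<exists>n\<in>{1..m}. (T ^^ n) x \<in> A \<and> n \<le> h ((T ^^ (2 * n)) x)}" for m :: nat
  have "(\<lambda>m. measure M (B m)) \<longlonglongrightarrow> measure M (\<Union>m. B m)"
  proof (rule finite_Lim_measure_incseq)
    show "range B \<subseteq> sets M" unfolding B_def by (auto; measurable)
    show "incseq B" unfolding B_def incseq_def by force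
  qed
  then have "measure M (\<Union>m. B m) \<le> t * integral\<^sup>L M h + 4 / t * measure M A"
    using measure_return_bounded_le[OF assms] by (intro LIMSEQ_le_const2) (auto simp: B_def)
  moreover have "(\<Union>m. B m) = {x \<in> space M. \<exists>n\<ge>1. (T ^^ n) x \<in> A \<and> n \<le> h ((T ^^ (2 * n)) x)}"
  proof safe
    fix x n assume "x \<in> space M" "1 \<le> n" "(T ^^ n) x \<in> A" "n \<le> h ((T ^^ (2 * n)) x)"
    then have "x \<in> B n" by (auto simp: B_def)
    then show "x \<in> (\<Union>m. B m)" by blast
  qed (auto simp: B_def)
  ultimately show ?thesis by simp
qed

text \<open>By invariance the exceptional set at time \<open>n\<close> has the measure of the set
  where \<open>g\<close> is at least \<open>n\<close>. These measures sum to at most the integral of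
  \<open>g\<close>, so Borel--Cantelli applies.\<close>

lemma AE_eventually_funpow_less:
  fixes g :: "'a \<Rightarrow> real"
  assumes g: "integrable M g" "\<And>x. x \<in> space M \<Longrightarrow> g x \<ge> 0"
  shows "AE x in M. \<forall>\<^sub>F n in sequentially. g ((T ^^ (2 * n)) x) < real n"
proof -
  have [measurable]: "g \<in> borel_measurable M" using g by auto
  \<comment> \<open>Levels start at 1: pointwise, the number of positive integers not exceeding
    \<open>g x\<close> is at most \<open>g x\<close>.\<close>
  define C where "C n = {x \<in> space M. real (Suc n) \<le> g x}" for n :: nat
  define D where "D n = {x \<in> space M. real n \<le> g ((T ^^ (2 * n)) x)}" for n :: nat
  have C [measurable]: "C n \<in> sets M" for n unfolding C_def by measurable
  have D [measurable]: "D n \<in> sets M" for n unfolding D_def by measurable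
  have CD: "measure M (D (Suc n)) = measure M (C n)" for n
  proof -
    have "measure M (C n) = measure (distr M M (T ^^ (2 * Suc n))) (C n)"
      by (simp add: measure_preserving_distr_funpow[OF mp] del: funpow.simps)
    also have "\<dots> = measure M ((T ^^ (2 * Suc n)) -` C n \<inter> space M)"
      by (rule measure_distr[OF funpow_measurable C])
    also have "(T ^^ (2 * Suc n)) -` C n \<inter> space M = D (Suc n)"
      using funpow_in_space[of _ "2 * Suc n"] by (auto simp: C_def D_def simp del: funpow.simps)
    finally show ?thesis ..
  qed
  have "summable (\<lambda>n. measure M (C n))"
  proof (rule bounded_imp_summable)
    fix N
    have "(\<Sum>n\<le>N. measure M (C n)) = integral\<^sup>L M (\<lambda>x. \<Sum>n\<le>N. indicator (C n) x)"
      by (simp add: emeasure_eq_measure)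
    also have "\<dots> \<le> integral\<^sup>L M g"
    proof (intro integral_mono g)
      fix x assume x: "x \<in> space M"
      have "(\<Sum>n\<le>N. indicator (C n) x :: real) = (\<Sum>n\<le>N. if Suc n \<le> g x then 1 else 0)"
        using x by (intro sum.cong) (auto simp: C_def indicator_def)
      also have "\<dots> = card {n\<in>{..N}. Suc n \<le> g x}"
        by (simp flip: sum.inter_filter)
      also have "\<dots> \<le> card {..<nat \<lfloor>g x\<rfloor>}"
        using le_nat_floor by (intro of_nat_mono card_mono) (auto simp: Suc_le_eq[symmetric])
      also have "\<dots> \<le> g x" using g(2)[OF x] by simp
      finally show "(\<Sum>n\<le>N. indicator (C n) x) \<le> g x" .
    qed (auto simp: emeasure_eq_measure)
    finally show "(\<Sum>n\<le>N. measure M (C n)) \<le> integral\<^sup>L M g" .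
  qed auto
  then have "summable (\<lambda>n. measure M (D n))"
    using CD by (subst summable_Suc_iff[symmetric]) simp
  then have "AE x in M. \<forall>\<^sub>F n in sequentially. x \<in> space M - D n"
    by (intro borel_cantelli_AE1) (auto simp: emeasure_eq_measure)
  then show ?thesis
    by eventually_elim (auto simp: D_def not_le elim!: eventually_mono)
qed

end

section \<open>Summation over the dyadic levels of \<open>f\<close>\<close>

lemma ex_dyadic_real:
  fixes r :: real
  assumes "r \<ge> 1"
  shows "\<exists>k. 2 ^ k \<le> r \<and> r < 2 ^ Suc k"
proof -
  obtain n where "r < 2 ^ n" using real_arch_pow[of 2 r] by auto
  then obtain m where m: "r < 2 ^ m" "\<And>i. i < m \<Longrightarrow> \<not> r < 2 ^ i"
    using exists_least_iff[of "\<lambda>n. r < 2 ^ n"] by auto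
  then obtain k where "m = Suc k" using assms by (cases m) auto
  then show ?thesis using m by (auto simp: not_less)
qed

theorem theorem2:
  fixes M :: "'a measure" and T :: "'a \<Rightarrow> 'a" and f g :: "'a \<Rightarrow> real" and \<alpha> :: real
  assumes "prob_space M"
    and "ergodic_map M T"
    and "non_atomic M"
    and "\<alpha> > 2"
    and "f \<in> borel_measurable M" and "\<And>x. x \<in> space M \<Longrightarrow> f x \<ge> 0"
    and "integrable M (\<lambda>x. f x * (logplus (f x)) powr (2 * \<alpha>))"
    and "\<And>x. x \<in> space M \<Longrightarrow> g x \<ge> 0"
    and "integrable M g"
  shows "AE x in M. (SUP n\<in>{1::nat..}. ereal (f ((T ^^ n) x) * g ((T ^^ (2 * n)) x) / real n)) < \<infinity>"
proof -
  interpret prob_space M by fact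
  have mp: "measure_preserving_map M T" using assms(2) by (simp add: ergodic_map_def)
  note [measurable] = funpow_measurable[OF assms(1) mp] assms(5)
  have g [measurable]: "g \<in> borel_measurable M" using assms(9) by auto
  define F where "F x = f x * (logplus (f x)) powr (2 * \<alpha>)" for x
  have F: "integrable M F" using assms(7) unfolding F_def .
  have F0: "F x \<ge> 0" if "x \<in> space M" for x using assms(6)[OF that] by (simp add: F_def)
  \<comment> \<open>Level indices are shifted by one, so that \<open>f\<close> is at least 2 on
    every \<open>A k\<close> and its logarithm is at least \<open>Suc k * ln 2\<close>.\<close>
  define A where "A k = {x \<in> space M. 2 ^ Suc k \<le> f x \<and> f x < 2 ^ Suc (Suc k)}" for k
  have A [measurable]: "A k \<in> sets M" for k unfolding A_def by measurable
  \<comment> \<open>On \<open>A k\<close> the factor \<open>2 ^ Suc (Suc k)\<close> exceeds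
    \<open>f\<close>, so outside \<open>B k\<close> every visit to \<open>A k\<close> at a time
    \<open>n\<close> of at least 1 has quotient at most 1.\<close>
  define B where "B k = {x \<in> space M. \<exists>n\<ge>1. (T ^^ n) x \<in> A k \<and>
      real n \<le> 2 ^ Suc (Suc k) * g ((T ^^ (2 * n)) x)}" for k
  have B [measurable]: "B k \<in> sets M" for k unfolding B_def by measurable
  \<comment> \<open>The reciprocal of the density threshold at level \<open>Suc k\<close>.\<close>
  define w where "w k = (2 ^ Suc k * (real (Suc k))\<^sup>2 :: real)" for k
  define c where "c = ln 2 powr (2 * \<alpha>)"
  have c: "c > 0" by (simp add: c_def)

  have disj: "disjoint_family A"
    unfolding disjoint_family_on_def
  proof (intro ballI impI)
    fix i j :: nat assume "i \<noteq> j"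
    show "A i \<inter> A j = {}"
    proof safe
      fix x assume x: "x \<in> A i" "x \<in> A j"
      then have "(2::real) ^ Suc i < 2 ^ Suc (Suc j)" "(2::real) ^ Suc j < 2 ^ Suc (Suc i)"
        unfolding A_def by (blast intro: le_less_trans)+
      then have "Suc i < Suc (Suc j)" "Suc j < Suc (Suc i)"
        by (meson one_less_numeral_iff power_less_imp_less_exp semiring_norm(76))+
      then show "x \<in> {}" using \<open>i \<noteq> j\<close> by simp
    qed
  qed
  have weight_le: "c * w k \<le> F x" if x: "x \<in> A k" for k x
  proof -
    have f: "2 ^ Suc k \<le> f x" using x by (simp add: A_def)
    have f1: "1 \<le> f x" using f one_le_power[of "2::real" "Suc k"] by linarith
    have "real (Suc k) * ln 2 = ln (2 ^ Suc k)" by (subst ln_realpow) auto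
    also have "\<dots> \<le> ln (f x)" using f f1 by (subst ln_le_cancel_iff) auto
    also have "\<dots> = logplus (f x)" using f1 by (simp add: logplus_def)
    finally have lp: "real (Suc k) * ln 2 \<le> logplus (f x)" .
    have "(real (Suc k))\<^sup>2 * c \<le> real (Suc k) powr (2 * \<alpha>) * c"
      using c assms(4) powr_mono[of 2 "2 * \<alpha>" "real (Suc k)"] by simp
    also have "\<dots> = (real (Suc k) * ln 2) powr (2 * \<alpha>)"
      by (simp add: c_def powr_mult)
    also have "\<dots> \<le> logplus (f x) powr (2 * \<alpha>)"
      using lp assms(4) by (intro powr_mono2) auto
    finally have "2 ^ Suc k * ((real (Suc k))\<^sup>2 * c) \<le> f x * logplus (f x) powr (2 * \<alpha>)"
      using f f1 c by (intro mult_mono) auto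
    then show ?thesis by (simp add: w_def F_def mult_ac)
  qed
  \<comment> \<open>The sets \<open>A k\<close> are disjoint and \<open>F\<close> is at least
    \<open>c * w k\<close> on each, so the partial sums stay below the integral of
    \<open>F\<close>.\<close>
  have "summable (\<lambda>k. c * w k * measure M (A k))"
  proof (rule bounded_imp_summable)
    fix N
    have "(\<Sum>k\<le>N. c * w k * measure M (A k)) = integral\<^sup>L M (\<lambda>x. \<Sum>k\<le>N. c * w k * indicator (A k) x)"
      by (subst Bochner_Integration.integral_sum) (simp_all add: emeasure_eq_measure)
    also have "\<dots> \<le> integral\<^sup>L M F"
    proof (intro integral_mono F)
      fix x assume x: "x \<in> space M"
      have "(\<Sum>k\<le>N. c * w k * indicator (A k) x) \<le> (\<Sum>k\<le>N. F x * indicator (A k) x)"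
        using weight_le by (intro sum_mono) (auto simp: indicator_def)
      also have "\<dots> = F x * indicator (\<Union>k\<le>N. A k) x"
        using disj by (subst indicator_UN_disjoint)
          (auto simp: sum_distrib_left intro: disjoint_family_on_mono)
      also have "\<dots> \<le> F x" using F0[OF x] by (simp add: indicator_def)
      finally show "(\<Sum>k\<le>N. c * w k * indicator (A k) x) \<le> F x" .
    qed (intro Bochner_Integration.integrable_sum integrable_mult_right, simp add: emeasure_eq_measure)
    finally show "(\<Sum>k\<le>N. c * w k * measure M (A k)) \<le> integral\<^sup>L M F" .
  qed (use c in \<open>auto simp: w_def\<close>)
  then have "summable (\<lambda>k. (1 / c) * (c * w k * measure M (A k)))"
    by (rule summable_mult)
  then have sumA: "summable (\<lambda>k. w k * measure M (A k))" using c by simp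
  have B_le: "measure M (B k) \<le> 2 * integral\<^sup>L M g * (1 / (real (Suc k))\<^sup>2) + 4 * (w k * measure M (A k))" for k
  proof -
    have w: "w k > 0" by (simp add: w_def)
    \<comment> \<open>With threshold \<open>1 / w k\<close> the powers of two cancel in the first
      term, leaving twice the integral of \<open>g\<close> over \<open>(Suc k)^2\<close>.\<close>
    have "measure M (B k) \<le> 1 / w k * integral\<^sup>L M (\<lambda>x. 2 ^ Suc (Suc k) * g x) + 4 / (1 / w k) * measure M (A k)"
      unfolding B_def using w assms(8,9)
      by (intro measure_return_le[OF assms(1) mp]) auto
    also have "\<dots> = 2 * integral\<^sup>L M g * (1 / (real (Suc k))\<^sup>2) + 4 * (w k * measure M (A k))"
      by (simp add: w_def)
    finally show ?thesis .
  qed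
  have "summable (\<lambda>k. 1 / (real (Suc k))\<^sup>2)"
    using inverse_squares_sums by (auto simp: sums_iff add.commute)
  then have "summable (\<lambda>k. 2 * integral\<^sup>L M g * (1 / (real (Suc k))\<^sup>2) + 4 * (w k * measure M (A k)))"
    using sumA by (intro summable_add summable_mult)
  then have "summable (\<lambda>k. measure M (B k))"
    by (rule summable_comparison_test'[where N = 0]) (use B_le in auto)
  then have "AE x in M. \<forall>\<^sub>F k in sequentially. x \<in> space M - B k"
    by (intro borel_cantelli_AE1) (auto simp: emeasure_eq_measure)
  moreover have "AE x in M. \<forall>\<^sub>F n in sequentially. g ((T ^^ (2 * n)) x) < real n"
    using assms(8,9) by (intro AE_eventually_funpow_less[OF assms(1) mp])
  ultimately show ?thesis
  proof (eventually_elim)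
    case (elim x)
    obtain K where K: "x \<in> space M" "\<And>k. k \<ge> K \<Longrightarrow> x \<notin> B k"
      using elim(1) by (auto simp: eventually_sequentially)
    obtain n0 where n0: "\<And>n. n \<ge> n0 \<Longrightarrow> g ((T ^^ (2 * n)) x) < real n"
      using elim(2) by (auto simp: eventually_sequentially)
    have sp: "(T ^^ n) x \<in> space M" for n by (rule funpow_in_space[OF assms(1) mp K(1)])
    define v where "v n = f ((T ^^ n) x) * g ((T ^^ (2 * n)) x) / real n" for n
    have v0: "v n \<ge> 0" for n using sp assms(6,8) by (simp add: v_def)
    \<comment> \<open>One summand for each case below: large values of \<open>f\<close>, moderate
      values at late times, and the finitely many early times. The entry \<open>v 0\<close> is a
      division by zero, hence 0.\<close>
    define C where "C = 1 + 2 ^ Suc K + (\<Sum>i<n0. v i)"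
    have S0: "(\<Sum>i<n0. v i) \<ge> 0" using v0 by (simp add: sum_nonneg)
    have "v n \<le> C" if n: "n \<ge> 1" for n
    proof -
      define a where "a = f ((T ^^ n) x)"
      define b where "b = g ((T ^^ (2 * n)) x)"
      have ab: "a \<ge> 0" "b \<ge> 0" "v n = a * b / n"
        using sp assms(6,8) by (auto simp: a_def b_def v_def)
      consider "n < n0" | "n \<ge> n0" "a < 2 ^ Suc K" | "2 ^ Suc K \<le> a" by linarith
      then show ?thesis
      proof cases
        case 1
        then have "v n \<le> (\<Sum>i<n0. v i)" using v0 by (intro member_le_sum) auto
        then show ?thesis using zero_le_power[of "2::real" "Suc K"] unfolding C_def by linarith
      next
        case 2
        have "b < n" using n0[OF 2(1)] by (simp add: b_def)
        then have "a * b \<le> 2 ^ Suc K * real n" using ab 2 by (intro mult_mono) auto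
        then have "v n \<le> 2 ^ Suc K" using ab(3) n by (simp add: pos_divide_le_eq)
        then show ?thesis using S0 unfolding C_def by linarith
      next
        case 3
        have "1 \<le> a" using 3 one_le_power[of "2::real" "Suc K"] by linarith
        then obtain m where m: "2 ^ m \<le> a" "a < 2 ^ Suc m" using ex_dyadic_real by blast
        have "(2::real) ^ Suc K < 2 ^ Suc m" using 3 m by linarith
        then have "Suc K < Suc m"
          by (meson one_less_numeral_iff power_less_imp_less_exp semiring_norm(76))
        \<comment> \<open>Undoes the index shift: \<open>A k\<close> is the level of exponent
          \<open>Suc k\<close>, and \<open>k \<ge> K\<close> puts \<open>x\<close> outside
          \<open>B k\<close>.\<close>
        then obtain k where k: "m = Suc k" "k \<ge> K" by (cases m) auto
        have "(T ^^ n) x \<in> A k" using m k sp by (auto simp: A_def a_def)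
        then have "2 ^ Suc (Suc k) * b < n"
          using K(2)[OF k(2)] K(1) n by (auto simp: B_def b_def not_le)
        moreover have "a * b \<le> 2 ^ Suc (Suc k) * b" using m k ab by (intro mult_right_mono) auto
        ultimately have "v n \<le> 1" using ab(3) n by (simp add: pos_divide_le_eq)
        then show ?thesis using S0 zero_le_power[of "2::real" "Suc K"] unfolding C_def by linarith
      qed
    qed
    then have "(SUP n\<in>{1::nat..}. ereal (v n)) \<le> ereal C"
      by (intro SUP_least) auto
    also have "\<dots> < \<infinity>" by simp
    finally show ?case by (simp only: v_def)
  qed
qed

end
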